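(* Let $0<\alpha\le 2$, $\nu>0$, let $(a_z)_{z\ge1}$ and $\theta>0$ be as in the context, and let $$h(y;\alpha,\nu,\theta)=\frac{\theta\, g(y;\alpha,\nu)\,A'\{\theta[1-G(y;\alpha,\nu)]\}}{A\{\theta[1-G(y;\alpha,\nu)]\}}$$ be the hazard rate of the rGTL-PS distribution. Then, for $y\to 0$, the hazard rate tends to $$\nu\theta(2-\alpha)\cdot\frac{A'(\theta)}{A(\theta)},$$ while for $y\to 1$ the hazard rate tends to $+\infty$.
   Context: For $0<\alpha\le 2$ and $\nu>0$, the reflected Generalized Topp-Leone distribution rGTL$(\alpha,\nu)$ on $[0,1]$ has cdf $G(y;\alpha,\nu)=1-(1-y)^{\nu}[\alpha-(\alpha-1)(1-y)]^{\nu}$ and density $g(y;\alpha,\nu)=\nu(1-y)^{\nu-1}[\alpha-(\alpha-1)(1-y)]^{\nu-1}[\alpha-2(\alpha-1)(1-y)]$. Let $a_z\ge 0$ ($z=1,2,\dots$) with $a_1>0$, and let $\theta>0$ be such that $A(\theta)=\sum_{z=1}^{\infty}a_z\theta^z$ is finite; $A'$ denotes the derivative of $A$ with respect to its argument, so that $A'(0)=a_1$. The rGTL-PS (reflected Generalized Topp-Leone Power Series) distribution with parameters $(\alpha,\nu,\theta)$ is the distribution on $[0,1]$ with cdf $F(y)=1-A\{\theta[1-G(y;\alpha,\nu)]\}/A(\theta)$ and density $f(y)=\theta g(y;\alpha,\nu)A'\{\theta[1-G(y;\alpha,\nu)]\}/A(\theta)$; it is the law of the minimum of $Z$ i.i.d.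 rGTL$(\alpha,\nu)$ variables, where $P(Z=z)=a_z\theta^z/A(\theta)$, $z\ge1$. Its hazard rate is $h=f/(1-F)$.
   Formalization: For y→0 the case α=2 with A'(θ)=+∞ (θ at the radius of convergence) is excluded, since the stated limit is then 0·∞ (e.g. A(x)=1−√(1−x), θ=1 gives √ν); A'(θ) is read as the left derivative, possibly +∞. *)

theory Defs
  imports "HOL-Analysis.Analysis"
begin

definition rgtl_cdf :: "real \<Rightarrow> real \<Rightarrow> real \<Rightarrow> real" where
  "rgtl_cdf \<alpha> \<nu> y = 1 - (1 - y) powr \<nu> * (\<alpha> - (\<alpha> - 1) * (1 - y)) powr \<nu>"

definition rgtl_pdf :: "real \<Rightarrow> real \<Rightarrow> real \<Rightarrow> real" where
  "rgtl_pdf \<alpha> \<nu> y =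
     \<nu> * (1 - y) powr (\<nu> - 1) * (\<alpha> - (\<alpha> - 1) * (1 - y)) powr (\<nu> - 1)
       * (\<alpha> - 2 * (\<alpha> - 1) * (1 - y))"

text \<open>The series starts at $z = 1$; the value \<open>a 0\<close> is never used.\<close>

definition ps_fun :: "(nat \<Rightarrow> real) \<Rightarrow> real \<Rightarrow> real" where
  "ps_fun a x = (\<Sum>n. a (Suc n) * x ^ Suc n)"

definition rgtlps_cdf :: "(nat \<Rightarrow> real) \<Rightarrow> real \<Rightarrow> real \<Rightarrow> real \<Rightarrow> real \<Rightarrow> real" where
  "rgtlps_cdf a \<alpha> \<nu> \<theta> y = 1 - ps_fun a (\<theta> * (1 - rgtl_cdf \<alpha> \<nu> y)) / ps_fun a \<theta>"

text \<open>For \<open>0 < y < 1\<close> the argument of the derivative lies strictly between 0 and \<open>\<theta>\<close>,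
  hence inside the open interval of convergence, so that \<^const>\<open>deriv\<close> is the genuine
  derivative there.\<close>

definition rgtlps_pdf :: "(nat \<Rightarrow> real) \<Rightarrow> real \<Rightarrow> real \<Rightarrow> real \<Rightarrow> real \<Rightarrow> real" where
  "rgtlps_pdf a \<alpha> \<nu> \<theta> y =
     \<theta> * rgtl_pdf \<alpha> \<nu> y * deriv (ps_fun a) (\<theta> * (1 - rgtl_cdf \<alpha> \<nu> y)) / ps_fun a \<theta>"

definition rgtlps_hazard :: "(nat \<Rightarrow> real) \<Rightarrow> real \<Rightarrow> real \<Rightarrow> real \<Rightarrow> real \<Rightarrow> real" where
  "rgtlps_hazard a \<alpha> \<nu> \<theta> y = rgtlps_pdf a \<alpha> \<nu> \<theta> y / (1 - rgtlps_cdf a \<alpha> \<nu> \<theta> y)"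

lemma rgtlps_hazard_eq:
  assumes "ps_fun a \<theta> \<noteq> 0"
  shows "rgtlps_hazard a \<alpha> \<nu> \<theta> y =
    \<theta> * rgtl_pdf \<alpha> \<nu> y * deriv (ps_fun a) (\<theta> * (1 - rgtl_cdf \<alpha> \<nu> y))
      / ps_fun a (\<theta> * (1 - rgtl_cdf \<alpha> \<nu> y))"
  using assms by (simp add: rgtlps_hazard_def rgtlps_pdf_def rgtlps_cdf_def)

text \<open>Finiteness of the series at \<open>\<theta>\<close> allows \<open>\<theta>\<close> to be the radius of convergence. The
  derivative at \<open>\<theta>\<close> is then one-sided and may be infinite, so it is taken as an extended real
  left derivative.\<close>

definition left_deriv :: "(real \<Rightarrow> real) \<Rightarrow> real \<Rightarrow> ereal" where
  "left_deriv f x = Lim (at_left x) (\<lambda>t. ereal ((f t - f x) / (t - x)))"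

lemma left_deriv_eq_deriv:
  assumes "f field_differentiable (at x)"
  shows "left_deriv f x = ereal (deriv f x)"
proof -
  have "(f has_field_derivative deriv f x) (at x within {..<x})"
    using assms DERIV_deriv_iff_field_differentiable has_field_derivative_at_within by blast
  then have "((\<lambda>t. (f t - f x) / (t - x)) \<longlongrightarrow> deriv f x) (at_left x)"
    by (simp add: has_field_derivative_iff)
  then have "((\<lambda>t. ereal ((f t - f x) / (t - x))) \<longlongrightarrow> ereal (deriv f x)) (at_left x)"
    by simp
  then show ?thesis
    unfolding left_deriv_def by (intro tendsto_Lim) (simp_all add: trivial_limit_at_left_real)
qed

end

(* With s = (1 - y) (\<alpha> - (\<alpha> - 1) (1 - y)), decreasing from 1 to 0, one has 1 - G = s^\<nu> and
   g = \<nu> s^(\<nu> - 1) (-s').  Since A' is increasing on (0, \<theta>) and A is left-continuous at \<theta>, the mean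
   value theorem squeezes the left difference quotients of A between A'(t) and sup A', so A'(x) tends
   to the left derivative of A at \<theta>, finite or not; this gives the limit at 0.  At 1, the termwise
   inequality A(x) \<le> x A'(x) bounds the hazard rate from below by \<nu> (-s') / s. *)
theory Submission
  imports Defs
begin

text \<open>The entry at index 0 is set to 0 because \<open>a 0\<close> is arbitrary. This turns
  \<open>ps_fun a\<close> into an ordinary power series in \<open>x ^ n\<close>, the form in which
  termwise differentiation is stated.\<close>

definition ps_coeff :: "(nat \<Rightarrow> real) \<Rightarrow> nat \<Rightarrow> real" where
  "ps_coeff a n = (if n = 0 then 0 else a n)"

lemma ps_coeff_simps [simp]: "ps_coeff a 0 = 0" "ps_coeff a (Suc n) = a (Suc n)"
  by (simp_all add: ps_coeff_def)

text \<open>Nothing is assumed about differentiability at \<open>b\<close>, so an infinite left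
  derivative is covered: by monotonicity \<open>f'\<close> converges in \<open>ereal\<close> to its
  supremum, which also turns out to be the limit of the difference quotients.\<close>

lemma left_deriv_eq_lim_deriv:
  fixes f f' :: "real \<Rightarrow> real"
  assumes "c < b" and cont: "continuous_on {c..b} f"
    and der: "\<And>x. c < x \<Longrightarrow> x < b \<Longrightarrow> (f has_real_derivative f' x) (at x)"
    and mono: "\<And>x y. c < x \<Longrightarrow> x \<le> y \<Longrightarrow> y < b \<Longrightarrow> f' x \<le> f' y"
  shows "((\<lambda>x. ereal (f' x)) \<longlongrightarrow> left_deriv f b) (at_left b)"
proof -
  define L where "L = (SUP x\<in>{c<..<b}. ereal (f' x))"
  have upper: "ereal (f' x) \<le> L" if "c < x" "x < b" for x
    unfolding L_def using that by (intro SUP_upper) auto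
  have ev: "\<forall>\<^sub>F x in at_left b. c < x \<and> x < b"
    using \<open>c < b\<close> by (auto simp: eventually_at_left)
  have lim: "((\<lambda>x. ereal (f' x)) \<longlongrightarrow> L) (at_left b)"
  proof (rule order_tendstoI)
    fix l assume "l < L"
    then obtain x where x: "c < x" "x < b" "l < ereal (f' x)"
      unfolding L_def less_SUP_iff by auto
    have "\<forall>\<^sub>F y in at_left b. x < y \<and> y < b"
      using x by (auto simp: eventually_at_left)
    then show "\<forall>\<^sub>F y in at_left b. l < ereal (f' y)"
    proof eventually_elim
      case (elim y)
      with x mono[of x y] have "ereal (f' x) \<le> ereal (f' y)" by simp
      with x show ?case by (rule_tac less_le_trans)
    qed
  next
    fix u assume "L < u"
    from ev show "\<forall>\<^sub>F y in at_left b. ereal (f' y) < u"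
      by eventually_elim (use upper \<open>L < u\<close> le_less_trans in blast)
  qed
  \<comment> \<open>The quotient equals \<open>f' z\<close> for some \<open>z\<close> strictly
    between \<open>t\<close> and \<open>b\<close>; monotonicity bounds it below by
    \<open>f' t\<close>, the supremum bounds it above.\<close>
  have bounds: "f' t \<le> (f t - f b) / (t - b) \<and> ereal ((f t - f b) / (t - b)) \<le> L"
    if t: "c < t" "t < b" for t
  proof -
    have "continuous_on {t..b} f"
      using cont t by (auto intro: continuous_on_subset)
    moreover have "f differentiable (at x)" if "t < x" "x < b" for x
      using der[of x] that t real_differentiable_def by auto
    ultimately obtain l z where z: "t < z" "z < b" "DERIV f z :> l" "f b - f t = (b - t) * l"
      using MVT[OF \<open>t < b\<close>, of f] by blast
    then have "l = f' z" using der[of z] t DERIV_unique by auto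
    then have "(f t - f b) / (t - b) = f' z"
      using z t by (simp add: field_simps)
    then show ?thesis using upper[of z] mono[of t z] z t by auto
  qed
  have "((\<lambda>t. ereal ((f t - f b) / (t - b))) \<longlongrightarrow> L) (at_left b)"
  proof (rule tendsto_sandwich[OF _ _ lim tendsto_const])
    show "\<forall>\<^sub>F t in at_left b. ereal (f' t) \<le> ereal ((f t - f b) / (t - b))"
      using ev by eventually_elim (use bounds in auto)
    show "\<forall>\<^sub>F t in at_left b. ereal ((f t - f b) / (t - b)) \<le> L"
      using ev by eventually_elim (use bounds in auto)
  qed
  then have "left_deriv f b = L"
    unfolding left_deriv_def by (intro tendsto_Lim) (simp_all add: trivial_limit_at_left_real)
  with lim show ?thesis by simp
qed

section \<open>The power series A and its derivative up to the endpoint \<theta>\<close>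

locale power_series_family =
  fixes a :: "nat \<Rightarrow> real" and \<theta> :: real
  assumes nonneg: "\<And>z. z \<ge> 1 \<Longrightarrow> 0 \<le> a z" and a1: "0 < a 1"
    and \<theta>_pos: "0 < \<theta>" and summable_\<theta>: "summable (\<lambda>n. a (Suc n) * \<theta> ^ Suc n)"
begin

lemma nonneg_Suc: "0 \<le> a (Suc n)"
  by (rule nonneg) simp

lemma term_le: "0 \<le> x \<Longrightarrow> x \<le> y \<Longrightarrow> a (Suc n) * x ^ Suc n \<le> a (Suc n) * y ^ Suc n"
  by (intro mult_left_mono power_mono nonneg_Suc)

lemma summable_ps: 
  assumes "0 \<le> x" "x \<le> \<theta>" shows "summable (\<lambda>n. a (Suc n) * x ^ Suc n)"
proof (rule summable_comparison_test'[OF summable_\<theta>])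
  show "norm (a (Suc n) * x ^ Suc n) \<le> a (Suc n) * \<theta> ^ Suc n" for n
    using term_le[OF assms] nonneg_Suc[of n] assms by (simp add: abs_mult)
qed

lemma ps_fun_pos: 
  assumes "0 < x" "x \<le> \<theta>" shows "0 < ps_fun a x"
  unfolding ps_fun_def
  \<comment> \<open>Index 0 is the linear term \<open>a 1 * x\<close>, the one whose coefficient is
    known to be positive.\<close>
  by (rule suminf_pos2[OF summable_ps, of _ 0]) (use assms a1 nonneg_Suc in auto)

text \<open>The terms at \<theta> are a Weierstrass majorant on the closed interval, so continuity
  reaches \<theta> even when \<theta> is the radius of convergence.\<close>

lemma continuous_on_ps_fun: "continuous_on {0..\<theta>} (ps_fun a)"
proof -
  have "uniform_limit {0..\<theta>} (\<lambda>n x. \<Sum>i<n. a (Suc i) * x ^ Suc i) (ps_fun a) sequentially"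
    unfolding ps_fun_def
  proof (rule Weierstrass_m_test[OF _ summable_\<theta>])
    show "norm (a (Suc n) * x ^ Suc n) \<le> a (Suc n) * \<theta> ^ Suc n" if "x \<in> {0..\<theta>}" for n x
      using that term_le[of x \<theta> n] nonneg_Suc[of n] by (auto simp: abs_mult)
  qed
  then show ?thesis
    by (rule uniform_limit_theorem[rotated]) (auto intro!: always_eventually continuous_intros)
qed

lemma summable_coeff: "summable (\<lambda>n. ps_coeff a n * \<theta> ^ n)"
  using summable_\<theta> by (subst summable_Suc_iff[symmetric]) simp

lemma summable_coeff_inside: "norm x < \<theta> \<Longrightarrow> summable (\<lambda>n. ps_coeff a n * x ^ n)"
  using powser_inside[OF summable_coeff] \<theta>_pos by simp

lemma summable_diffs: 
  assumes "norm x < \<theta>" shows "summable (\<lambda>n. diffs (ps_coeff a) n * x ^ n)"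
  by (rule termdiff_converges[OF assms]) (use summable_coeff_inside in auto)

lemma ps_fun_eq: 
  assumes "norm x < \<theta>" shows "ps_fun a x = (\<Sum>n. ps_coeff a n * x ^ n)"
  using suminf_split_head[OF summable_coeff_inside[OF assms]] by (simp add: ps_fun_def)

lemma deriv_ps_fun:
  assumes "norm x < \<theta>"
  shows "(ps_fun a has_real_derivative deriv (ps_fun a) x) (at x)"
    and "deriv (ps_fun a) x = (\<Sum>n. diffs (ps_coeff a) n * x ^ n)"
proof -
  have "((\<lambda>x. \<Sum>n. ps_coeff a n * x ^ n) has_real_derivative
      (\<Sum>n. diffs (ps_coeff a) n * x ^ n)) (at x)"
    by (rule termdiffs_strong[OF summable_coeff]) (use assms \<theta>_pos in auto)
  then have "(ps_fun a has_real_derivative (\<Sum>n. diffs (ps_coeff a) n * x ^ n)) (at x)"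
    by (rule has_field_derivative_transform_within_open[where S = "ball 0 \<theta>"])
       (use assms ps_fun_eq in auto)
  then show "deriv (ps_fun a) x = (\<Sum>n. diffs (ps_coeff a) n * x ^ n)"
    and "(ps_fun a has_real_derivative deriv (ps_fun a) x) (at x)"
    by (simp_all add: DERIV_imp_deriv)
qed

lemma diffs_nonneg: "0 \<le> diffs (ps_coeff a) n"
  using nonneg_Suc by (simp add: diffs_def)

lemma deriv_ps_fun_mono:
  assumes "0 \<le> x" "x \<le> y" "y < \<theta>"
  shows "deriv (ps_fun a) x \<le> deriv (ps_fun a) y"
proof -
  have "norm x < \<theta>" "norm y < \<theta>" using assms by auto
  then show ?thesis
    by (auto simp: deriv_ps_fun intro!: suminf_le summable_diffs mult_left_mono diffs_nonneg 
        power_mono assms)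
qed

text \<open>In x A'(x) each term of A(x) is multiplied by its degree, which is at least 1 because
  the series starts at degree 1.\<close>

lemma ps_fun_le_deriv:
  assumes "0 \<le> x" "x < \<theta>"
  shows "ps_fun a x \<le> x * deriv (ps_fun a) x"
proof -
  have x: "norm x < \<theta>" using assms by simp
  have "ps_fun a x \<le> (\<Sum>n. x * (diffs (ps_coeff a) n * x ^ n))"
    unfolding ps_fun_def
  proof (rule suminf_le)
    fix n
    have "1 * (a (Suc n) * x ^ Suc n) \<le> real (Suc n) * (a (Suc n) * x ^ Suc n)"
      by (intro mult_right_mono mult_nonneg_nonneg nonneg_Suc zero_le_power assms) simp
    then show "a (Suc n) * x ^ Suc n \<le> x * (diffs (ps_coeff a) n * x ^ n)"
      by (simp add: diffs_def mult_ac)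
  qed (use assms summable_ps summable_diffs[OF x] in \<open>auto intro: summable_mult\<close>)
  also have "\<dots> = x * deriv (ps_fun a) x"
    by (simp add: deriv_ps_fun(2)[OF x] suminf_mult[OF summable_diffs[OF x]])
  finally show ?thesis .
qed

lemma deriv_ps_fun_tendsto_left_deriv:
  "((\<lambda>x. ereal (deriv (ps_fun a) x)) \<longlongrightarrow> left_deriv (ps_fun a) \<theta>) (at_left \<theta>)"
  by (rule left_deriv_eq_lim_deriv[OF \<theta>_pos continuous_on_ps_fun])
     (auto intro: deriv_ps_fun(1) deriv_ps_fun_mono)

text \<open>Excludes the value minus infinity when the limit of a product is taken in
  \<open>ereal\<close>.\<close>

lemma left_deriv_ps_fun_nonneg: "0 \<le> left_deriv (ps_fun a) \<theta>"
proof (rule tendsto_lowerbound[OF deriv_ps_fun_tendsto_left_deriv])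
  have "0 \<le> deriv (ps_fun a) x" if "0 < x" "x < \<theta>" for x
    using that by (auto simp: deriv_ps_fun intro!: suminf_nonneg summable_diffs mult_nonneg_nonneg diffs_nonneg)
  then show "\<forall>\<^sub>F x in at_left \<theta>. 0 \<le> ereal (deriv (ps_fun a) x)"
    using \<theta>_pos by (auto simp: eventually_at_left)
qed (simp add: trivial_limit_at_left_real)

end

section \<open>The rGTL law through its base s, which on [0,1] is the survival function of
  rGTL(\<alpha>, 1)\<close>

definition rgtl_base :: "real \<Rightarrow> real \<Rightarrow> real" where
  "rgtl_base \<alpha> y = (1 - y) * (\<alpha> - (\<alpha> - 1) * (1 - y))"

context
  fixes \<alpha> y :: real
  assumes \<alpha>: "0 < \<alpha>" "\<alpha> \<le> 2" and y: "0 < y" "y < 1"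
begin

text \<open>The factor is the convex combination of \<alpha> and 1 with weights y and 1 - y.\<close>

lemma rgtl_factor_pos: "0 < \<alpha> - (\<alpha> - 1) * (1 - y)"
proof -
  have "\<alpha> - (\<alpha> - 1) * (1 - y) = \<alpha> * y + (1 - y)" by (simp add: algebra_simps)
  then show ?thesis using \<alpha> y by (simp add: add_pos_pos)
qed

text \<open>This is -s', the convex combination of 2 - \<alpha> and \<alpha> with weights 1 - y and
  y; the second summand stays positive when \<alpha> = 2.\<close>

lemma rgtl_slope_pos: "0 < \<alpha> - 2 * (\<alpha> - 1) * (1 - y)"
proof -
  have "\<alpha> - 2 * (\<alpha> - 1) * (1 - y) = (2 - \<alpha>) * (1 - y) + \<alpha> * y" by (simp add: algebra_simps)
  then show ?thesis using \<alpha> y by (simp add: add_nonneg_pos)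
qed

lemma rgtl_base_pos: "0 < rgtl_base \<alpha> y"
  unfolding rgtl_base_def using rgtl_factor_pos y by simp

lemma rgtl_base_less_1: "rgtl_base \<alpha> y < 1"
proof -
  have "1 - rgtl_base \<alpha> y = y * ((2 - \<alpha>) * (1 - y) + y)"
    by (simp add: rgtl_base_def algebra_simps)
  moreover have "0 < y * ((2 - \<alpha>) * (1 - y) + y)"
    using \<alpha> y by (intro mult_pos_pos add_nonneg_pos) auto
  ultimately show ?thesis by simp
qed

lemma rgtl_survival_eq: "1 - rgtl_cdf \<alpha> \<nu> y = rgtl_base \<alpha> y powr \<nu>"
  unfolding rgtl_cdf_def rgtl_base_def using rgtl_factor_pos y by (simp add: powr_mult)

lemma rgtl_pdf_eq:
  "rgtl_pdf \<alpha> \<nu> y = \<nu> * rgtl_base \<alpha> y powr (\<nu> - 1) * (\<alpha> - 2 * (\<alpha> - 1) * (1 - y))"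
  unfolding rgtl_pdf_def rgtl_base_def using rgtl_factor_pos y by (simp add: powr_mult)

end

lemma rgtl_survival_tendsto:
  "((\<lambda>y. 1 - rgtl_cdf \<alpha> \<nu> y) \<longlongrightarrow> 1) (at_right 0)"
proof -
  have "isCont (\<lambda>y. 1 - rgtl_cdf \<alpha> \<nu> y) 0"
    unfolding rgtl_cdf_def by (intro continuous_intros) auto
  then have "((\<lambda>y. 1 - rgtl_cdf \<alpha> \<nu> y) \<longlongrightarrow> 1 - rgtl_cdf \<alpha> \<nu> 0) (at_right 0)"
    unfolding isCont_def by (rule tendsto_within_subset) simp
  then show ?thesis by (simp add: rgtl_cdf_def)
qed

lemma rgtl_pdf_tendsto:
  "(rgtl_pdf \<alpha> \<nu> \<longlongrightarrow> \<nu> * (2 - \<alpha>)) (at_right 0)"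
proof -
  \<comment> \<open>At y = 0 both bases equal 1, so the powers are continuous there whatever the
    sign of \<nu> - 1.\<close>
  have "isCont (rgtl_pdf \<alpha> \<nu>) 0"
    unfolding rgtl_pdf_def[abs_def] by (intro continuous_intros) auto
  then have "(rgtl_pdf \<alpha> \<nu> \<longlongrightarrow> rgtl_pdf \<alpha> \<nu> 0) (at_right 0)"
    unfolding isCont_def by (rule tendsto_within_subset) simp
  then show ?thesis by (simp add: rgtl_pdf_def algebra_simps)
qed

section \<open>Limits of the hazard rate at 0 and at 1\<close>

context power_series_family
begin

context
  fixes \<alpha> \<nu> :: real
  assumes \<alpha>: "0 < \<alpha>" "\<alpha> \<le> 2" and \<nu>: "0 < \<nu>"
begin

lemma scaled_survival_bounds:
  assumes "0 < y" "y < 1"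
  shows "0 < \<theta> * (1 - rgtl_cdf \<alpha> \<nu> y)" "\<theta> * (1 - rgtl_cdf \<alpha> \<nu> y) < \<theta>"
  using rgtl_base_pos[OF \<alpha> assms] rgtl_base_less_1[OF \<alpha> assms] \<theta>_pos \<nu>
    powr_less_mono2[of \<nu> "rgtl_base \<alpha> y" 1]
  by (simp_all add: rgtl_survival_eq[OF \<alpha> assms])

text \<open>Approach strictly from below is essential: the limit of A' is known only along
  \<open>at_left \<theta>\<close>.\<close>

lemma scaled_survival_at_left:
  "filterlim (\<lambda>y. \<theta> * (1 - rgtl_cdf \<alpha> \<nu> y)) (at_left \<theta>) (at_right 0)"
proof (rule tendsto_imp_filterlim_at_left)
  show "((\<lambda>y. \<theta> * (1 - rgtl_cdf \<alpha> \<nu> y)) \<longlongrightarrow> \<theta>) (at_right 0)"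
    using tendsto_mult[OF tendsto_const[of \<theta>] rgtl_survival_tendsto] by simp
  show "\<forall>\<^sub>F y in at_right 0. \<theta> * (1 - rgtl_cdf \<alpha> \<nu> y) < \<theta>"
    unfolding eventually_at_right_field using scaled_survival_bounds(2) zero_less_one by blast
qed

text \<open>The excluded case is the indeterminate form 0 times infinity, which \<open>ereal\<close>
  evaluates to 0 although the hazard rate need not tend to 0.\<close>

lemma hazard_tendsto_at_0:
  assumes "\<not> (\<alpha> = 2 \<and> left_deriv (ps_fun a) \<theta> = \<infinity>)"
  shows "((\<lambda>y. ereal (rgtlps_hazard a \<alpha> \<nu> \<theta> y)) \<longlongrightarrow>
           ereal (\<nu> * \<theta> * (2 - \<alpha>)) * (left_deriv (ps_fun a) \<theta> / ereal (ps_fun a \<theta>)))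
          (at_right 0)"
proof -
  let ?x = "\<lambda>y. \<theta> * (1 - rgtl_cdf \<alpha> \<nu> y)"
  let ?D = "left_deriv (ps_fun a) \<theta>" and ?A = "ps_fun a \<theta>"
  have A: "0 < ?A" using ps_fun_pos \<theta>_pos by simp
  have "(ps_fun a \<longlongrightarrow> ?A) (at \<theta> within {0..\<theta>})"
    using continuous_on_ps_fun \<theta>_pos by (auto simp: continuous_on_def)
  then have "(ps_fun a \<longlongrightarrow> ?A) (at_left \<theta>)"
    using \<theta>_pos by (simp add: at_within_Icc_at_left)
  then have "((\<lambda>y. ps_fun a (?x y)) \<longlongrightarrow> ?A) (at_right 0)"
    by (rule filterlim_compose[OF _ scaled_survival_at_left])
  then have "((\<lambda>y. \<theta> * rgtl_pdf \<alpha> \<nu> y / ps_fun a (?x y)) \<longlongrightarrow> \<theta> * (\<nu> * (2 - \<alpha>)) / ?A) (at_right 0)"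
    using A by (intro tendsto_intros rgtl_pdf_tendsto) auto
  then have 1: "((\<lambda>y. ereal (\<theta> * rgtl_pdf \<alpha> \<nu> y / ps_fun a (?x y))) \<longlongrightarrow>
      ereal (\<theta> * (\<nu> * (2 - \<alpha>)) / ?A)) (at_right 0)"
    by simp
  have 2: "((\<lambda>y. ereal (deriv (ps_fun a) (?x y))) \<longlongrightarrow> ?D) (at_right 0)"
    by (rule filterlim_compose[OF deriv_ps_fun_tendsto_left_deriv scaled_survival_at_left])
  have "((\<lambda>y. ereal (\<theta> * rgtl_pdf \<alpha> \<nu> y / ps_fun a (?x y)) * ereal (deriv (ps_fun a) (?x y)))
      \<longlongrightarrow> ereal (\<theta> * (\<nu> * (2 - \<alpha>)) / ?A) * ?D) (at_right 0)"
    \<comment> \<open>The first limit is finite and vanishes only for \<alpha> = 2; then the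
      assumption and nonnegativity make the second limit finite.\<close>
    by (rule tendsto_mult_ereal[OF 1 2])
       (use assms \<theta>_pos \<nu> A left_deriv_ps_fun_nonneg in auto)
  moreover have "ereal (\<theta> * (\<nu> * (2 - \<alpha>)) / ?A) * ?D = ereal (\<nu> * \<theta> * (2 - \<alpha>)) * (?D / ereal ?A)"
    using A by (cases ?D) (auto simp: field_simps zero_less_mult_iff mult_less_0_iff)
  moreover have "(\<lambda>y. ereal (rgtlps_hazard a \<alpha> \<nu> \<theta> y)) =
      (\<lambda>y. ereal (\<theta> * rgtl_pdf \<alpha> \<nu> y / ps_fun a (?x y)) * ereal (deriv (ps_fun a) (?x y)))"
    using A by (simp add: rgtlps_hazard_eq)
  ultimately show ?thesis by simp
qed

text \<open>The left side is the rGTL hazard rate g / (1 - G). The rGTL-PS hazard rate is this times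
  x A'(x) / A(x) at x = \<theta> (1 - G), a factor of at least 1 by
  \<open>ps_fun_le_deriv\<close>.\<close>

lemma hazard_lower_bound:
  assumes y: "0 < y" "y < 1"
  shows "\<nu> * (\<alpha> - 2 * (\<alpha> - 1) * (1 - y)) / rgtl_base \<alpha> y \<le> rgtlps_hazard a \<alpha> \<nu> \<theta> y"
proof -
  define x where "x = \<theta> * (1 - rgtl_cdf \<alpha> \<nu> y)"
  let ?s = "rgtl_base \<alpha> y" and ?c = "\<nu> * (\<alpha> - 2 * (\<alpha> - 1) * (1 - y))"
  have x: "0 < x" "x < \<theta>" using scaled_survival_bounds[OF y] by (auto simp: x_def)
  have s: "0 < ?s" by (rule rgtl_base_pos[OF \<alpha> y])
  have c: "0 < ?c" using rgtl_slope_pos[OF \<alpha> y] \<nu> by simp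
  have "\<theta> * rgtl_pdf \<alpha> \<nu> y = x * (?c / ?s)"
    using s by (simp add: x_def rgtl_survival_eq[OF \<alpha> y] rgtl_pdf_eq[OF \<alpha> y] powr_diff)
  then have "rgtlps_hazard a \<alpha> \<nu> \<theta> y = ?c / ?s * (x * deriv (ps_fun a) x / ps_fun a x)"
    using ps_fun_pos[of \<theta>] \<theta>_pos by (simp add: rgtlps_hazard_eq flip: x_def)
  moreover have "1 \<le> x * deriv (ps_fun a) x / ps_fun a x"
    using ps_fun_pos[of x] ps_fun_le_deriv[of x] x by simp
  ultimately show ?thesis
    using mult_left_mono[of 1 "x * deriv (ps_fun a) x / ps_fun a x" "?c / ?s"] c s by simp
qed

lemma hazard_at_top_at_1: "filterlim (rgtlps_hazard a \<alpha> \<nu> \<theta>) at_top (at_left 1)"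
proof -
  have ev: "\<forall>\<^sub>F y in at_left 1. 0 < y \<and> y < (1::real)"
    unfolding eventually_at_left_field using zero_less_one by blast
  \<comment> \<open>The limits are left unevaluated so that \<open>tendsto_intros\<close> can match
    them; they are \<nu> \<alpha> > 0 for the numerator and 0, approached from above, for s.\<close>
  have "((\<lambda>y. \<nu> * (\<alpha> - 2 * (\<alpha> - 1) * (1 - y))) \<longlongrightarrow> \<nu> * (\<alpha> - 2 * (\<alpha> - 1) * (1 - 1))) (at_left 1)"
    by (intro tendsto_intros)
  moreover have "(rgtl_base \<alpha> \<longlongrightarrow> (1 - 1) * (\<alpha> - (\<alpha> - 1) * (1 - 1))) (at_left 1)"
    unfolding rgtl_base_def[abs_def] by (intro tendsto_intros)
  moreover have "\<forall>\<^sub>F y in at_left 1. 0 < rgtl_base \<alpha> y"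
    using ev by eventually_elim (use rgtl_base_pos[OF \<alpha>] in auto)
  ultimately have
    "filterlim (\<lambda>y. \<nu> * (\<alpha> - 2 * (\<alpha> - 1) * (1 - y)) / rgtl_base \<alpha> y) at_top (at_left 1)"
    by (intro LIM_at_top_divide[where a = "\<nu> * \<alpha>"]) (use \<alpha> \<nu> in simp_all)
  then show ?thesis
    by (rule filterlim_at_top_mono) (use ev hazard_lower_bound in \<open>auto elim: eventually_mono\<close>)
qed

end

end

theorem mainTheorem2:
  fixes a :: "nat \<Rightarrow> real" and \<alpha> \<nu> \<theta> :: real
  assumes "0 < \<alpha>" and "\<alpha> \<le> 2" and "0 < \<nu>"
    and "\<And>z. z \<ge> 1 \<Longrightarrow> 0 \<le> a z" and "0 < a 1"
    and "0 < \<theta>" and "summable (\<lambda>n. a (Suc n) * \<theta> ^ Suc n)"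
  shows "(\<not> (\<alpha> = 2 \<and> left_deriv (ps_fun a) \<theta> = \<infinity>) \<longrightarrow>
            ((\<lambda>y. ereal (rgtlps_hazard a \<alpha> \<nu> \<theta> y)) \<longlongrightarrow>
               ereal (\<nu> * \<theta> * (2 - \<alpha>)) * (left_deriv (ps_fun a) \<theta> / ereal (ps_fun a \<theta>)))
              (at_right 0))
         \<and> filterlim (rgtlps_hazard a \<alpha> \<nu> \<theta>) at_top (at_left 1)"
proof -
  interpret power_series_family a \<theta>
    using assms by unfold_locales
  show ?thesis
    using hazard_tendsto_at_0 hazard_at_top_at_1 assms(1-3) by blast
qed

end
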